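(* Let $S_t$ denote the star with $t$ leaves. Then, as $n\to\infty$: (i) $C(n,S_4)=\Omega(n^{1/3})$; (ii) $C(n,S_t)=\Omega(n^{1/2})$ for every $t\geqslant 5$.
   Context: For a graph $H$ and a positive integer $n$, $C(n,H)$ denotes the minimum integer $k$ such that there exist $n$ colorings $f_v:E(K_n)\to[k]$, one for each vertex $v\in V(K_n)$ (the colorings need not be proper), with the following property: for every copy $T$ of $H$ in $K_n$, there is a vertex $v\in V(T)$ such that $f_v$ assigns pairwise distinct colors to all edges of $E(T)$. *)

theory Defs
  imports Complex_Main "HOL-Library.Landau_Symbols" "HOL-Library.Ramsey"
begin

text \<open>A graph is a pair of a vertex set and a set of edges, each edge being a
  two-element set of vertices.\<close>

type_synonym 'a graph = "'a set \<times> 'a set set"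

abbreviation verts :: "'a graph \<Rightarrow> 'a set" where
  "verts G \<equiv> fst G"

abbreviation edges :: "'a graph \<Rightarrow> 'a set set" where
  "edges G \<equiv> snd G"

definition subgraph :: "'a graph \<Rightarrow> 'a graph \<Rightarrow> bool" where
  "subgraph T G \<longleftrightarrow> verts T \<subseteq> verts G \<and> edges T \<subseteq> edges G"

definition graph_isomorphic :: "'a graph \<Rightarrow> 'b graph \<Rightarrow> bool" where
  "graph_isomorphic H T \<longleftrightarrow>
    (\<exists>\<phi>. bij_betw \<phi> (verts H) (verts T) \<and> edges T = (\<lambda>e. \<phi> ` e) ` edges H)"

definition is_copy_in :: "'b graph \<Rightarrow> 'a graph \<Rightarrow> 'b graph \<Rightarrow> bool" where
  "is_copy_in T H G \<longleftrightarrow> subgraph T G \<and> graph_isomorphic H T"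

definition complete_graph :: "nat \<Rightarrow> nat graph" where
  "complete_graph n = ({..<n}, nsets {..<n} 2)"

text \<open>Vertex \<open>0\<close> is the centre and \<open>1, \<dots>, t\<close> are the leaves.\<close>

definition star :: "nat \<Rightarrow> nat graph" where
  "star t = ({0..t}, {{0, i} | i. i \<in> {1..t}})"

definition good_colorings ::
  "nat \<Rightarrow> 'a graph \<Rightarrow> nat \<Rightarrow> (nat \<Rightarrow> nat set \<Rightarrow> nat) \<Rightarrow> bool" where
  "good_colorings n H k f \<longleftrightarrow>
    (\<forall>v\<in>verts (complete_graph n). \<forall>e\<in>edges (complete_graph n). f v e \<in> {1..k}) \<and>
    (\<forall>T. is_copy_in T H (complete_graph n) \<longrightarrow>
       (\<exists>v\<in>verts T. inj_on (f v) (edges T)))"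

definition C :: "nat \<Rightarrow> 'a graph \<Rightarrow> nat" where
  "C n H = (LEAST k. \<exists>f. good_colorings n H k f)"

text \<open>The minimum is attained whenever \<open>H\<close> has a vertex.\<close>

lemma ex_good_colorings_C:
  assumes "verts H \<noteq> {}"
  shows "\<exists>f. good_colorings n H (C n H) f"
proof -
  let ?E = "edges (complete_graph n)"
  have "finite ?E"
    by (simp add: complete_graph_def finite_imp_finite_nsets)
  then obtain h where h: "bij_betw h ?E {1..card ?E}"
    using finite_same_card_bij[of ?E "{1..card ?E}"] by auto
  have "good_colorings n H (card ?E) (\<lambda>_. h)"
    unfolding good_colorings_def
  proof (intro conjI ballI allI impI)
    fix e assume "e \<in> ?E"
    then show "h e \<in> {1..card ?E}"
      using h by (rule bij_betw_apply[rotated])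
  next
    fix T assume T: "is_copy_in T H (complete_graph n)"
    then have "edges T \<subseteq> ?E"
      by (simp add: is_copy_in_def subgraph_def)
    then have "inj_on h (edges T)"
      using h by (meson bij_betw_imp_inj_on inj_on_subset)
    moreover have "verts T \<noteq> {}"
      using T assms by (auto simp: is_copy_in_def graph_isomorphic_def bij_betw_def)
    ultimately show "\<exists>v\<in>verts T. inj_on h (edges T)"
      by blast
  qed
  then have "\<exists>k f. good_colorings n H k f"
    by blast
  then show ?thesis
    unfolding C_def by (rule LeastI_ex)
qed

end

theory Submission
  imports Defs
begin

text \<open>Fix the centre \<open>0\<close> of a star. Its leaves \<open>x\<close> are then coloured by
  \<open>x \<mapsto> f v {0, x}\<close>, one colouring for each vertex \<open>v\<close>. Choose \<open>2k\<close> leaves having the same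
  colour for \<open>v = 0\<close>. Every \<open>v\<close> identifies at least \<open>k\<close> of the \<open>4k\<^sup>2\<close> ordered pairs of these
  leaves, so some pair \<open>y, z\<close> is identified by a set \<open>S\<close> of about \<open>n / 4k\<close> leaves \<open>v\<close>, and also
  by \<open>0\<close>. A star containing \<open>y\<close>, \<open>z\<close> and otherwise leaves in \<open>S\<close> can therefore only be rainbow
  for \<open>y\<close> or for \<open>z\<close>. If \<open>S\<close> has more than \<open>k\<^sup>2\<close> elements, two of them are identified by both \<open>y\<close>
  and \<open>z\<close>, which excludes four leaves. If \<open>S\<close> has more than \<open>2k\<close> elements, some \<open>x \<in> S\<close> is
  identified with some \<open>w \<in> S\<close> by \<open>y\<close> and with some \<open>u \<in> S\<close> by \<open>z\<close>, which excludes five or more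
  leaves.\<close>

section \<open>Double counting of identified pairs\<close>

text \<open>The elements whose colour is shared with no other are coloured injectively, so at most
  \<open>card K\<close> of them exist.\<close>

lemma card_le_card_repeated_plus:
  assumes "finite Y" "finite K" "h ` Y \<subseteq> K"
  shows "card Y \<le> card {y\<in>Y. \<exists>z\<in>Y. z \<noteq> y \<and> h z = h y} + card K"
proof -
  let ?D = "{y\<in>Y. \<exists>z\<in>Y. z \<noteq> y \<and> h z = h y}"
  have "inj_on h (Y - ?D)"
    by (auto simp: inj_on_def)
  then have "card (Y - ?D) \<le> card K"
    using assms by (intro card_inj_on_le[of h]) auto
  moreover have "card Y = card ?D + card (Y - ?D)"
    using assms(1) card_Un_disjoint[of ?D "Y - ?D"] by (simp add: Un_absorb1)
  ultimately show ?thesis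
    by simp
qed

text \<open>Count incidences between \<open>v\<close> and ordered pairs of distinct elements that
  \<open>g v\<close> identifies: each \<open>v\<close> contributes at least
  \<open>card Y - card K\<close>, and there are at most \<open>(card Y)\<^sup>2\<close>
  pairs.\<close>

lemma exists_popular_pair:
  fixes g :: "'v \<Rightarrow> 'a \<Rightarrow> 'c"
  assumes "finite V" "finite Y" "finite K"
    and col: "\<And>v. v \<in> V \<Longrightarrow> g v ` Y \<subseteq> K"
    and large: "q * (card Y)\<^sup>2 < card V * (card Y - card K)"
  shows "\<exists>y\<in>Y. \<exists>z\<in>Y. y \<noteq> z \<and> q < card {v\<in>V. g v y = g v z}"
proof (rule ccontr)
  assume "\<not> ?thesis"
  then have few: "card {v\<in>V. g v y = g v z} \<le> q" if "y \<in> Y" "z \<in> Y" "y \<noteq> z" for y z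
    using that by (meson not_less)
  let ?P = "{p \<in> Y \<times> Y. fst p \<noteq> snd p}"
  let ?R = "\<lambda>v p. g v (fst p) = g v (snd p)"
  have finP: "finite ?P"
    using assms(2) by simp
  have many: "card Y - card K \<le> card {p\<in>?P. ?R v p}" if "v \<in> V" for v
  proof -
    \<comment> \<open>Every repeated element is the first component of an identified pair.\<close>
    have "{y\<in>Y. \<exists>z\<in>Y. z \<noteq> y \<and> g v z = g v y} \<subseteq> fst ` {p\<in>?P. ?R v p}"
      by (force simp: image_iff)
    then have "card {y\<in>Y. \<exists>z\<in>Y. z \<noteq> y \<and> g v z = g v y} \<le> card {p\<in>?P. ?R v p}"
      by (rule surj_card_le[rotated]) (rule finite_subset[OF _ finP], blast)
    then show ?thesis
      using card_le_card_repeated_plus[OF assms(2,3) col[OF that]] by linarith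
  qed
  have "card V * (card Y - card K) \<le> (\<Sum>v\<in>V. card {p\<in>?P. ?R v p})"
    using sum_mono[OF many] by simp
  also have "\<dots> = (\<Sum>p\<in>?P. card {v\<in>V. ?R v p})"
    using sum.swap_restrict[OF assms(1) finP, of "\<lambda>_ _. 1::nat" ?R] by simp
  also have "\<dots> \<le> card ?P * q"
    using sum_bounded_above[of ?P "\<lambda>p. card {v\<in>V. ?R v p}" q] few by auto
  also have "\<dots> \<le> card (Y \<times> Y) * q"
    using assms(2) by (intro mult_right_mono card_mono) auto
  also have "\<dots> = q * (card Y)\<^sup>2"
    by (simp add: card_cartesian_product power2_eq_square)
  finally show False
    using large by simp
qed

text \<open>Here \<open>h\<close> stands for the colouring of the centre. The bound
  \<open>card K \<le> q\<close> makes \<open>V\<close> large enough for some class of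
  \<open>h\<close> to contain \<open>2 * card K\<close> elements. This size maximises
  \<open>(m - card K) / m\<^sup>2\<close> over \<open>m\<close>, whence the factor 4.\<close>

lemma exists_popular_monochromatic_pair:
  fixes g :: "'v \<Rightarrow> 'v \<Rightarrow> 'c"
  assumes "finite V" "finite K" "K \<noteq> {}"
    and h: "h ` V \<subseteq> K"
    and g: "\<And>v. v \<in> V \<Longrightarrow> g v ` V \<subseteq> K"
    and "card K \<le> q" "4 * q * card K < card V"
  shows "\<exists>y\<in>V. \<exists>z\<in>V. y \<noteq> z \<and> h y = h z \<and> q < card {v\<in>V. g v y = g v z}"
proof -
  have k: "0 < card K"
    using assms by (simp add: card_gt_0_iff)
  have "2 * card K * card K \<le> 4 * q * card K"
    using assms(6) by (intro mult_right_mono) auto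
  then have "\<not> card V \<le> card K * (2 * card K)"
    using assms(7) by (simp only: mult.commute not_le)
  moreover have "card V = (\<Sum>c\<in>K. card {x\<in>V. h x = c})"
    using sum.group[OF assms(1,2) h, of "\<lambda>_. 1::nat"] by simp
  moreover have "(\<Sum>c\<in>K. card {x\<in>V. h x = c}) \<le> card K * (2 * card K)"
    if "\<And>c. c \<in> K \<Longrightarrow> card {x\<in>V. h x = c} \<le> 2 * card K"
    using sum_bounded_above[of K "\<lambda>c. card {x\<in>V. h x = c}" "2 * card K"] that by simp
  ultimately obtain c where "2 * card K \<le> card {x\<in>V. h x = c}"
    by (metis nat_le_linear)
  then obtain Y where Y: "Y \<subseteq> {x\<in>V. h x = c}" "card Y = 2 * card K" "finite Y"
    by (rule obtain_subset_with_card_n)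
  have "q * (card Y)\<^sup>2 = 4 * q * card K * card K"
    by (simp add: Y(2) power2_eq_square)
  also have "\<dots> < card V * card K"
    using assms(7) k by simp
  finally have "q * (card Y)\<^sup>2 < card V * (card Y - card K)"
    by (simp add: Y(2))
  moreover have "g v ` Y \<subseteq> K" if "v \<in> V" for v
    using g[OF that] Y(1) by blast
  ultimately have "\<exists>y\<in>Y. \<exists>z\<in>Y. y \<noteq> z \<and> q < card {v\<in>V. g v y = g v z}"
    using exists_popular_pair[OF assms(1) Y(3) assms(2), of g q] by blast
  then show ?thesis
    using Y(1) by blast
qed

section \<open>Leaf sets that are rainbow for no vertex of the star\<close>

lemma not_inj_onI:
  "\<lbrakk>x \<in> A; y \<in> A; x \<noteq> y; f x = f y\<rbrakk> \<Longrightarrow> \<not> inj_on f A"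
  by (auto simp: inj_on_def)

lemma exists_non_rainbow_4_set:
  fixes g :: "'v \<Rightarrow> 'v \<Rightarrow> 'c"
  assumes "finite V" "finite K" "K \<noteq> {}"
    and h: "h ` V \<subseteq> K"
    and g: "\<And>v. v \<in> V \<Longrightarrow> g v ` V \<subseteq> K"
    and "4 * ((card K)\<^sup>2 + 2) * card K < card V"
  shows "\<exists>X\<subseteq>V. card X = 4 \<and> \<not> inj_on h X \<and> (\<forall>x\<in>X. \<not> inj_on (g x) X)"
proof -
  have "card K \<le> (card K)\<^sup>2 + 2"
    by (simp add: power2_eq_square trans_le_add1 le_SucI)
  then have "\<exists>y\<in>V. \<exists>z\<in>V. y \<noteq> z \<and> h y = h z \<and> (card K)\<^sup>2 + 2 < card {v\<in>V. g v y = g v z}"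
    using exists_popular_monochromatic_pair[OF assms(1-5) _ assms(6)] by simp
  then obtain y z where yz: "y \<in> V" "z \<in> V" "y \<noteq> z" "h y = h z"
      and q: "(card K)\<^sup>2 + 2 < card {v\<in>V. g v y = g v z}"
    by blast
  \<comment> \<open>Dropping \<open>y\<close> and \<open>z\<close> keeps the four leaves distinct;
    the \<open>+ 2\<close> in the threshold pays for it.\<close>
  define W where "W = {v\<in>V. g v y = g v z} - {y, z}"
  have "(card K)\<^sup>2 < card W"
    using q diff_card_le_card_Diff[of "{y, z}" "{v\<in>V. g v y = g v z}"] yz(3)
    by (simp add: W_def)
  moreover have "(\<lambda>w. (g y w, g z w)) ` W \<subseteq> K \<times> K"
    using g yz by (auto simp: W_def)
  ultimately have "\<not> inj_on (\<lambda>w. (g y w, g z w)) W"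
    using card_inj_on_le[of "\<lambda>w. (g y w, g z w)" W "K \<times> K"] assms(2)
    by (auto simp: card_cartesian_product power2_eq_square)
  then obtain x w where xw: "x \<in> W" "w \<in> W" "x \<noteq> w" "g y x = g y w" "g z x = g z w"
    by (auto simp: inj_on_def)
  let ?X = "{y, z, x, w}"
  have "\<not> inj_on (g v) ?X" if "v \<in> ?X" for v
  proof (cases "v \<in> W")
    case True
    then show ?thesis
      using yz by (intro not_inj_onI[of y _ z]) (auto simp: W_def)
  next
    case False
    then show ?thesis
      using that xw by (intro not_inj_onI[of x _ w]) auto
  qed
  moreover have "\<not> inj_on h ?X"
    using yz by (intro not_inj_onI[of y _ z]) auto
  moreover have "?X \<subseteq> V" "card ?X = 4"
    using yz xw by (auto simp: W_def)
  ultimately show ?thesis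
    by (intro exI[of _ ?X]) simp
qed

text \<open>With a fifth leaf, \<open>y\<close> and \<open>z\<close> may fail on different pairs
  that share one element. A popularity threshold linear in \<open>card K\<close> then replaces the
  quadratic one, which improves the exponent from 1/3 to 1/2.\<close>

lemma exists_non_rainbow_set:
  fixes g :: "'v \<Rightarrow> 'v \<Rightarrow> 'c"
  assumes "finite V" "finite K" "K \<noteq> {}" "5 \<le> t"
    and h: "h ` V \<subseteq> K"
    and g: "\<And>v. v \<in> V \<Longrightarrow> g v ` V \<subseteq> K"
    and "4 * (2 * card K + t) * card K < card V"
  shows "\<exists>X\<subseteq>V. card X = t \<and> \<not> inj_on h X \<and> (\<forall>x\<in>X. \<not> inj_on (g x) X)"
proof -
  have "\<exists>y\<in>V. \<exists>z\<in>V. y \<noteq> z \<and> h y = h z \<and> 2 * card K + t < card {v\<in>V. g v y = g v z}"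
    using exists_popular_monochromatic_pair[OF assms(1-3,5,6) _ assms(7)] by simp
  then obtain y z where yz: "y \<in> V" "z \<in> V" "y \<noteq> z" "h y = h z"
      and q: "2 * card K + t < card {v\<in>V. g v y = g v z}"
    by blast
  define W where "W = {v\<in>V. g v y = g v z} - {y, z}"
  have W: "2 * card K + t - 2 < card W"
    using q diff_card_le_card_Diff[of "{y, z}" "{v\<in>V. g v y = g v z}"] yz(3) assms(4)
    by (simp add: W_def)
  have finW: "finite W"
    using assms(1) by (simp add: W_def)
  define D where "D v = {x\<in>W. \<exists>w\<in>W. w \<noteq> x \<and> g v w = g v x}" for v
  have D: "card W \<le> card (D v) + card K" if "v \<in> V" for v
    unfolding D_def using g[OF that] finW assms(2)
    by (intro card_le_card_repeated_plus) (auto simp: W_def)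
  \<comment> \<open>Each of \<open>D y\<close> and \<open>D z\<close> misses at most
    \<open>card K\<close> elements of \<open>W\<close>, which has more than
    \<open>2 * card K\<close>.\<close>
  have "D y \<inter> D z \<noteq> {}"
  proof
    assume "D y \<inter> D z = {}"
    then have "card (D y) + card (D z) = card (D y \<union> D z)"
      using finW by (subst card_Un_disjoint) (auto simp: D_def)
    also have "\<dots> \<le> card W"
      using finW by (intro card_mono) (auto simp: D_def)
    finally show False
      using D[OF yz(1)] D[OF yz(2)] W assms(4) by linarith
  qed
  then obtain x w u where xwu: "x \<in> W" "w \<in> W" "u \<in> W" "w \<noteq> x" "u \<noteq> x"
      "g y w = g y x" "g z u = g z x"
    by (auto simp: D_def)
  \<comment> \<open>Since \<open>w\<close> and \<open>u\<close> may coincide, only an upper bound of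
    3 holds; it fits because \<open>5 \<le> t\<close>. The summand \<open>t\<close> in the threshold
    leaves room to pad inside \<open>W\<close>.\<close>
  have "card {x, w, u} \<le> t - 2"
    using assms(4) card_length[of "[x, w, u]"] by simp
  moreover have "t - 2 \<le> card W"
    using W by simp
  moreover have "{x, w, u} \<subseteq> W"
    using xwu by simp
  ultimately obtain R where R: "{x, w, u} \<subseteq> R" "R \<subseteq> W" "card R = t - 2"
    using exists_subset_between[OF _ _ _ finW] by metis
  let ?X = "insert y (insert z R)"
  have "\<not> inj_on (g v) ?X" if v: "v \<in> ?X" for v
  proof -
    consider "v = y" | "v = z" | "v \<in> W"
      using v R(2) by blast
    then show ?thesis
    proof cases
      case 1
      then show ?thesis
        using xwu R(1) by (intro not_inj_onI[of w _ x]) auto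
    next
      case 2
      then show ?thesis
        using xwu R(1) by (intro not_inj_onI[of u _ x]) auto
    next
      case 3
      then show ?thesis
        using yz by (intro not_inj_onI[of y _ z]) (auto simp: W_def)
    qed
  qed
  moreover have "\<not> inj_on h ?X"
    using yz by (intro not_inj_onI[of y _ z]) auto
  moreover have "?X \<subseteq> V"
    using yz R(2) by (auto simp: W_def)
  moreover have "card ?X = t"
  proof -
    have "finite R" "y \<notin> insert z R" "z \<notin> R"
      using R(2) finW yz(3) by (auto simp: W_def finite_subset)
    then show ?thesis
      using R(3) assms(4) by simp
  qed
  ultimately show ?thesis
    by (intro exI[of _ ?X]) simp
qed

section \<open>Stars centred at \<open>0\<close>\<close>

lemma star_copy_in_complete_graph:
  assumes X: "X \<subseteq> {1..<n}" "card X = t" and "0 < n"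
  shows "is_copy_in (insert 0 X, (\<lambda>x. {0, x}) ` X) (star t) (complete_graph n)"
proof -
  have finX: "finite X"
    using X(1) finite_subset by blast
  obtain p where p: "bij_betw p {1..t} X"
    using finX X(2) finite_same_card_bij[of "{1..t}" X] by auto
  define \<phi> where "\<phi> i = (if i = 0 then 0 else p i)" for i
  have "bij_betw \<phi> {1..t} X"
    using p by (subst bij_betw_cong[of _ _ p]) (auto simp: \<phi>_def)
  then have "bij_betw \<phi> ({1..t} \<union> {0}) (X \<union> {\<phi> 0})"
    using X(1) by (intro notIn_Un_bij_betw) (auto simp: \<phi>_def)
  moreover have "{1..t} \<union> {0} = {0..t}"
    by auto
  ultimately have bij: "bij_betw \<phi> {0..t} (insert 0 X)"
    by (simp add: \<phi>_def)
  have "(\<lambda>x. {0, x}) ` X = (\<lambda>i. \<phi> ` {0, i}) ` {1..t}"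
    using p by (auto simp: bij_betw_def \<phi>_def image_iff)
  also have "\<dots> = (\<lambda>e. \<phi> ` e) ` {{0, i} | i. i \<in> {1..t}}"
    unfolding Setcompr_eq_image image_image by simp
  finally have "(\<lambda>x. {0, x}) ` X = (\<lambda>e. \<phi> ` e) ` {{0, i} | i. i \<in> {1..t}}" .
  moreover have "(\<lambda>x. {0, x}) ` X \<subseteq> nsets {..<n} 2"
    using X(1) assms(3) by (auto simp: nsets_def)
  ultimately show ?thesis
    using X(1) assms(3) bij
    by (auto simp: is_copy_in_def subgraph_def graph_isomorphic_def complete_graph_def star_def)
qed

text \<open>Since \<open>x \<mapsto> {0, x}\<close> is injective, being rainbow on edges becomes
  injectivity on leaves.\<close>

lemma good_colorings_star_rainbow:
  assumes good: "good_colorings n (star t) k f" and X: "X \<subseteq> {1..<n}" "card X = t" and "0 < n"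
  shows "inj_on (\<lambda>x. f 0 {0, x}) X \<or> (\<exists>v\<in>X. inj_on (\<lambda>x. f v {0, x}) X)"
proof -
  obtain v where v: "v \<in> insert 0 X" "inj_on (f v) ((\<lambda>x. {0, x}) ` X)"
    using good star_copy_in_complete_graph[OF X assms(4)]
    unfolding good_colorings_def by (metis fst_conv snd_conv)
  have "inj_on (\<lambda>x. {0, x}) X"
    by (auto simp: inj_on_def doubleton_eq_iff)
  then have "inj_on (\<lambda>x. f v {0, x}) X"
    using comp_inj_on[OF _ v(2)] by (simp add: o_def)
  then show ?thesis
    using v(1) by auto
qed

lemma good_colorings_range:
  assumes "good_colorings n H k f" "v < n"
  shows "(\<lambda>x. f v {0, x}) ` {1..<n} \<subseteq> {1..k}"
proof -
  have "{0, x} \<in> edges (complete_graph n)" if "x \<in> {1..<n}" for x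
    using that by (auto simp: complete_graph_def nsets_def)
  then show ?thesis
    using assms by (auto simp: good_colorings_def complete_graph_def)
qed

lemma good_colorings_positive:
  assumes "good_colorings n H k f" "2 \<le> n"
  shows "0 < k"
proof -
  have "f 0 {0, 1} \<in> {1..k}"
    using good_colorings_range[OF assms(1), of 0] assms(2) by (simp add: image_subset_iff)
  then show ?thesis
    by simp
qed

section \<open>Polynomial bounds on \<open>n\<close> and their asymptotic form\<close>

lemma good_colorings_star_4_bound:
  assumes good: "good_colorings n (star 4) k f" and "2 \<le> n"
  shows "n \<le> 13 * k ^ 3"
proof (rule ccontr)
  assume n: "\<not> ?thesis"
  have k: "1 \<le> k"
    using good_colorings_positive[OF assms] by simp
  \<comment> \<open>The threshold is at most \<open>12 * k ^ 3\<close>; one more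
    \<open>k ^ 3\<close> absorbs the loss from \<open>n\<close> vertices to \<open>n - 1\<close>
    leaves.\<close>
  have "k ^ 1 \<le> k ^ 3"
    using k by (intro power_increasing) auto
  moreover have "4 * (k\<^sup>2 + 2) * k = 4 * k ^ 3 + 8 * k"
    by (simp add: algebra_simps power2_eq_square power3_eq_cube)
  ultimately have "4 * (k\<^sup>2 + 2) * k < n - 1"
    using n k by simp
  then have "\<exists>X\<subseteq>{1..<n}. card X = 4 \<and> \<not> inj_on (\<lambda>x. f 0 {0, x}) X \<and>
      (\<forall>v\<in>X. \<not> inj_on (\<lambda>x. f v {0, x}) X)"
    using k good_colorings_range[OF good] assms(2-)
    by (intro exists_non_rainbow_4_set[where K = "{1..k}"]) simp_all
  then obtain X where X: "X \<subseteq> {1..<n}" "card X = 4"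
      "\<not> inj_on (\<lambda>x. f 0 {0, x}) X" "\<forall>v\<in>X. \<not> inj_on (\<lambda>x. f v {0, x}) X"
    by blast
  then show False
    using good_colorings_star_rainbow[OF good X(1,2)] assms(2) by simp
qed

lemma good_colorings_star_bound:
  assumes good: "good_colorings n (star t) k f" and "2 \<le> n" "5 \<le> t"
  shows "n \<le> (4 * t + 9) * k\<^sup>2"
proof (rule ccontr)
  assume n: "\<not> ?thesis"
  have k: "1 \<le> k"
    using good_colorings_positive[OF assms(1,2)] by simp
  \<comment> \<open>The threshold is at most \<open>(4 * t + 8) * k\<^sup>2\<close>; the spare
    \<open>k\<^sup>2\<close> again covers the step to \<open>n - 1\<close> leaves.\<close>
  have "t * k \<le> t * k\<^sup>2" "1 \<le> k\<^sup>2"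
    using k by (auto simp: power2_eq_square)
  moreover have "4 * (2 * k + t) * k = 8 * k\<^sup>2 + 4 * (t * k)"
    by (simp add: algebra_simps power2_eq_square)
  moreover have "(4 * t + 9) * k\<^sup>2 = 4 * (t * k\<^sup>2) + 9 * k\<^sup>2"
    by (simp add: algebra_simps)
  ultimately have "4 * (2 * k + t) * k < n - 1"
    using n by linarith
  then have "\<exists>X\<subseteq>{1..<n}. card X = t \<and> \<not> inj_on (\<lambda>x. f 0 {0, x}) X \<and>
      (\<forall>v\<in>X. \<not> inj_on (\<lambda>x. f v {0, x}) X)"
    using k good_colorings_range[OF good] assms(2-)
    by (intro exists_non_rainbow_set[where K = "{1..k}"]) simp_all
  then obtain X where X: "X \<subseteq> {1..<n}" "card X = t"
      "\<not> inj_on (\<lambda>x. f 0 {0, x}) X" "\<forall>v\<in>X. \<not> inj_on (\<lambda>x. f v {0, x}) X"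
    by blast
  then show False
    using good_colorings_star_rainbow[OF good X(1,2)] assms(2) by simp
qed

text \<open>Taking \<open>d\<close>-th roots of the bound gives the estimate with constant
  \<open>B powr (1 / real d)\<close>.\<close>

lemma bigomega_root_if_le_power:
  fixes a :: "nat \<Rightarrow> nat"
  assumes "0 < d" and bound: "\<And>n. 2 \<le> n \<Longrightarrow> n \<le> B * a n ^ d"
  shows "(\<lambda>n. real (a n)) \<in> \<Omega>(\<lambda>n. real n powr (1 / real d))"
proof -
  have "norm (real n powr (1 / real d)) \<le> real B powr (1 / real d) * norm (real (a n))"
    if "2 \<le> n" for n
  proof -
    \<comment> \<open>\<open>powr_realpow\<close> requires a positive base; \<open>a n = 0\<close>
      would force \<open>n = 0\<close>.\<close>
    have "0 < a n"
      using bound[OF that] that assms(1) by (cases "a n = 0") (auto simp: zero_power)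
    have "real n \<le> real B * real (a n) ^ d"
      using bound[OF that] by (metis of_nat_le_iff of_nat_mult of_nat_power)
    then have "real n powr (1 / real d) \<le> (real B * real (a n) ^ d) powr (1 / real d)"
      by (intro powr_mono2) auto
    also have "\<dots> = real B powr (1 / real d) * real (a n)"
      using \<open>0 < a n\<close> assms(1) by (simp add: powr_mult powr_powr flip: powr_realpow)
    finally show ?thesis
      by simp
  qed
  then have "(\<lambda>n. real n powr (1 / real d)) \<in> O(\<lambda>n. real (a n))"
    by (intro bigoI) (auto intro: eventually_sequentiallyI)
  then show ?thesis
    by (simp add: bigomega_iff_bigo)
qed

theorem theorem5:
  shows "(\<lambda>n. real (C n (star 4))) \<in> \<Omega>(\<lambda>n. real n powr (1/3)) \<and>
         (\<forall>t\<ge>5. (\<lambda>n. real (C n (star t))) \<in> \<Omega>(\<lambda>n. real n powr (1/2)))"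
proof (intro conjI allI impI)
  have attained: "\<exists>f. good_colorings n (star t) (C n (star t)) f" for n t
    by (rule ex_good_colorings_C) (simp add: star_def)
  have "n \<le> 13 * C n (star 4) ^ 3" if "2 \<le> n" for n
    using attained good_colorings_star_4_bound that by blast
  then show "(\<lambda>n. real (C n (star 4))) \<in> \<Omega>(\<lambda>n. real n powr (1/3))"
    using bigomega_root_if_le_power[of 3 13 "\<lambda>n. C n (star 4)"] by simp
  fix t :: nat
  assume "5 \<le> t"
  then have "n \<le> (4 * t + 9) * (C n (star t))\<^sup>2" if "2 \<le> n" for n
    using attained good_colorings_star_bound that by blast
  then show "(\<lambda>n. real (C n (star t))) \<in> \<Omega>(\<lambda>n. real n powr (1/2))"
    using bigomega_root_if_le_power[of 2 "4 * t + 9" "\<lambda>n. C n (star t)"] by simp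
qed

end
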